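(* If $f=(F,f_3)$ is a conformal map of an open set in $\mathbb{H}_1$, then $S_{CL}(f)=0$ (at all points where $S_{CL}(f)$ is defined, i.e. where $ZF\neq0$).
   Context: The Heisenberg group $\mathbb{H}_1$ is $\mathbb{C}\times\mathbb{R}$ with coordinates $(z,t)$, $z=x+iy$, and product $(z_1,t_1)(z_2,t_2)=(z_1+z_2,\,t_1+t_2+2\,\mathrm{Im}(z_1\bar z_2))$. Put $X=\partial_x+2y\,\partial_t$, $Y=\partial_y-2x\,\partial_t$, $Z=\frac12(X-iY)$, $\bar Z=\frac12(X+iY)$, $\theta=dt-2y\,dx+2x\,dy$. A local diffeomorphism $f=(f_1+if_2,f_3)=(F,f_3)$ is contact if $f^*\theta=\lambda_f\theta$ with $\lambda_f$ nowhere zero. A contact map is conformal if $(Xf_1)^2+(Xf_2)^2=(Yf_1)^2+(Yf_2)^2$ and $(Xf_1)(Yf_1)+(Xf_2)(Yf_2)=0$; conformal maps are known to be $C^\infty$. The classical type Schwarzian derivative of a map $f=(F,f_3)$ satisfying the contact equations $Xf_3-2f_2Xf_1+2f_1Xf_2=0$, $Yf_3-2f_2Yf_1+2f_1Yf_2=0$ is, at points where $ZF\neq0$, $$S_{CL}(f)=\frac{Z^3F}{ZF}-\frac32\left(\frac{Z^2F}{ZF}\right)^2 .$$ *)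

theory Defs
  imports "HOL-Analysis.Analysis"
begin

text \<open>
  The underlying manifold of the Heisenberg group is \<open>\<complex> \<times> \<real>\<close> with coordinates
  \<open>(z, t)\<close>, \<open>z = x + iy\<close>. The product \<open>(z\<^sub>1,t\<^sub>1)(z\<^sub>2,t\<^sub>2) = (z\<^sub>1+z\<^sub>2, t\<^sub>1+t\<^sub>2+2 Im (z\<^sub>1 cnj z\<^sub>2))\<close>
  enters below only through the left-invariant fields \<open>X\<close>, \<open>Y\<close> and the form \<open>\<theta>\<close>.
\<close>

type_synonym heis = "complex \<times> real"

text \<open>
  \<open>C\<^sup>k\<close> on an open set, by recursion on directional derivatives; in finite dimension this
  is the usual notion.
\<close>

primrec Ck_on :: "nat \<Rightarrow> 'a::euclidean_space set \<Rightarrow> ('a \<Rightarrow> 'b::euclidean_space) \<Rightarrow> bool" where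
  "Ck_on 0 U f \<longleftrightarrow> continuous_on U f"
| "Ck_on (Suc k) U f \<longleftrightarrow>
     (\<forall>p\<in>U. f differentiable (at p)) \<and>
     (\<forall>v. Ck_on k U (\<lambda>p. frechet_derivative f (at p) v))"

definition smooth_on :: "'a::euclidean_space set \<Rightarrow> ('a \<Rightarrow> 'b::euclidean_space) \<Rightarrow> bool" where
  "smooth_on U f \<longleftrightarrow> (\<forall>k. Ck_on k U f)"

definition diffeomorphism_between ::
  "'a::euclidean_space set \<Rightarrow> 'b::euclidean_space set \<Rightarrow> ('a \<Rightarrow> 'b) \<Rightarrow> bool" where
  "diffeomorphism_between V W f \<longleftrightarrow>
     open V \<and> open W \<and> bij_betw f V W \<and> smooth_on V f \<and> smooth_on W (inv_into V f)"

text \<open>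
  Diffeomorphisms are taken in the smooth category; conformal maps are known to be smooth.
\<close>

definition local_diffeomorphism_on ::
  "'a::euclidean_space set \<Rightarrow> ('a \<Rightarrow> 'b::euclidean_space) \<Rightarrow> bool" where
  "local_diffeomorphism_on U f \<longleftrightarrow>
     (\<forall>p\<in>U. \<exists>V W. p \<in> V \<and> V \<subseteq> U \<and> diffeomorphism_between V W f)"

definition Dx :: "(heis \<Rightarrow> 'b::real_normed_vector) \<Rightarrow> heis \<Rightarrow> 'b" where
  "Dx u p = frechet_derivative u (at p) (1, 0)"

definition Dy :: "(heis \<Rightarrow> 'b::real_normed_vector) \<Rightarrow> heis \<Rightarrow> 'b" where
  "Dy u p = frechet_derivative u (at p) (\<i>, 0)"

definition Dt :: "(heis \<Rightarrow> 'b::real_normed_vector) \<Rightarrow> heis \<Rightarrow> 'b" where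
  "Dt u p = frechet_derivative u (at p) (0, 1)"

definition Xf :: "(heis \<Rightarrow> 'b::real_normed_vector) \<Rightarrow> heis \<Rightarrow> 'b" where
  "Xf u p = Dx u p + (2 * Im (fst p)) *\<^sub>R Dt u p"

definition Yf :: "(heis \<Rightarrow> 'b::real_normed_vector) \<Rightarrow> heis \<Rightarrow> 'b" where
  "Yf u p = Dy u p - (2 * Re (fst p)) *\<^sub>R Dt u p"

definition Zf :: "(heis \<Rightarrow> complex) \<Rightarrow> heis \<Rightarrow> complex" where
  "Zf u p = (1/2) * (Xf u p - \<i> * Yf u p)"

text \<open>\<open>\<theta> = dt - 2y dx + 2x dy\<close> at \<open>p\<close>, applied to the tangent vector \<open>v = (dx + i dy, dt)\<close>.\<close>

definition contact_form :: "heis \<Rightarrow> heis \<Rightarrow> real" where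
  "contact_form p v = snd v - 2 * Im (fst p) * Re (fst v) + 2 * Re (fst p) * Im (fst v)"

definition pullback_form ::
  "(heis \<Rightarrow> heis) \<Rightarrow> (heis \<Rightarrow> heis \<Rightarrow> real) \<Rightarrow> heis \<Rightarrow> heis \<Rightarrow> real" where
  "pullback_form f \<omega> p v = \<omega> (f p) (frechet_derivative f (at p) v)"

definition contact_map_on :: "heis set \<Rightarrow> (heis \<Rightarrow> heis) \<Rightarrow> bool" where
  "contact_map_on U f \<longleftrightarrow>
     local_diffeomorphism_on U f \<and>
     (\<exists>l :: heis \<Rightarrow> real. \<forall>p\<in>U. l p \<noteq> 0 \<and>
        (\<forall>v. pullback_form f contact_form p v = l p * contact_form p v))"

definition conformal_map_on :: "heis set \<Rightarrow> (heis \<Rightarrow> heis) \<Rightarrow> bool" where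
  "conformal_map_on U f \<longleftrightarrow>
     contact_map_on U f \<and>
     (let f1 = (\<lambda>p. Re (fst (f p))); f2 = (\<lambda>p. Im (fst (f p))) in
       \<forall>p\<in>U. (Xf f1 p)\<^sup>2 + (Xf f2 p)\<^sup>2 = (Yf f1 p)\<^sup>2 + (Yf f2 p)\<^sup>2 \<and>
             Xf f1 p * Yf f1 p + Xf f2 p * Yf f2 p = 0)"

text \<open>Only meaningful at points where \<open>ZF \<noteq> 0\<close>, with \<open>F = fst \<circ> f\<close>.\<close>

definition S_CL :: "(heis \<Rightarrow> heis) \<Rightarrow> heis \<Rightarrow> complex" where
  "S_CL f p = (let F = (\<lambda>q. fst (f q)) in
     Zf (Zf (Zf F)) p / Zf F p - (3/2) * (Zf (Zf F) p / Zf F p)\<^sup>2)"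

end

theory Submission
  imports Defs
begin

text \<open>
  Write \<open>Zbar = (X + iY)/2\<close>, so that \<open>Z Zbar - Zbar Z = -2i \<partial>\<^sub>t\<close> and \<open>\<partial>\<^sub>t\<close> commutes with \<open>Z\<close> and
  \<open>Zbar\<close>. Conformality says \<open>ZF \<cdot> Zbar F = 0\<close>, hence \<open>Zbar F = 0\<close> near a point with \<open>ZF \<noteq> 0\<close>.
  Let \<open>h = ZF\<close> and \<open>k = cnj h = Zbar (cnj F)\<close>. The commutators give \<open>Zk = -2i \<partial>\<^sub>t (cnj F)\<close>, so
  \<open>Z\<^sup>2k = -2i \<partial>\<^sub>t Z (cnj F) = 0\<close>. The contact equations become \<open>Zf\<^sub>3 = i (cnj F) h\<close> and
  \<open>Zbar f\<^sub>3 = -i F k\<close>; computing \<open>\<partial>\<^sub>tf\<^sub>3\<close> from their commutator and comparing \<open>Z\<partial>\<^sub>tf\<^sub>3\<close> with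
  \<open>\<partial>\<^sub>tZf\<^sub>3\<close> yields \<open>2 h Zk + k Zh = 0\<close>. One more application of \<open>Z\<close>, with \<open>Z\<^sup>2k = 0\<close>, gives
  \<open>2 h Z\<^sup>2h = 3 (Zh)\<^sup>2\<close>, which is the vanishing of the Schwarzian.
\<close>

section \<open>Smooth functions\<close>

lemma frechet_derivative_cong_open:
  assumes "open U" "p \<in> U" "\<And>q. q \<in> U \<Longrightarrow> f q = g q"
  shows "frechet_derivative f (at p) = frechet_derivative g (at p)"
proof -
  \<comment> \<open>\<open>frechet_derivative\<close> is a choice among derivatives, so equivalence
    for every candidate \<open>D\<close> is enough, even where no derivative exists.\<close>
  have "(f has_derivative D) (at p) \<longleftrightarrow> (g has_derivative D) (at p)" for D
    using assms by (auto elim!: has_derivative_transform_within_open)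
  then show ?thesis
    unfolding frechet_derivative_def by simp
qed

lemma differentiable_cong_open:
  assumes "open U" "p \<in> U" "\<And>q. q \<in> U \<Longrightarrow> f q = g q" "f differentiable (at p)"
  shows "g differentiable (at p)"
  using assms unfolding differentiable_def by (meson has_derivative_transform_within_open)

text \<open>Off \<open>U\<close> the functions need not be differentiable, so a computed formula for
  a derivative is known only on \<open>U\<close>. This lemma allows such a formula to replace
  \<open>frechet_derivative\<close> in the inductions on \<open>k\<close> below.\<close>

lemma Ck_on_cong:
  assumes "open U" "\<And>q. q \<in> U \<Longrightarrow> f q = g q" "Ck_on k U f"
  shows "Ck_on k U g"
  using assms(2,3)
proof (induction k arbitrary: f g)
  case 0
  then show ?case by (simp cong: continuous_on_cong)
next
  case (Suc k)
  have "g differentiable (at p)" if "p \<in> U" for p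
    using differentiable_cong_open[OF assms(1) that Suc.prems(1)] Suc.prems(2) that by auto
  moreover have "Ck_on k U (\<lambda>p. frechet_derivative g (at p) v)" for v
  proof (rule Suc.IH)
    show "Ck_on k U (\<lambda>p. frechet_derivative f (at p) v)" using Suc.prems(2) by simp
    show "frechet_derivative f (at q) v = frechet_derivative g (at q) v" if "q \<in> U" for q
      using frechet_derivative_cong_open[OF assms(1) that Suc.prems(1)] by simp
  qed
  ultimately show ?case by simp
qed

lemma Ck_on_SucD: "Ck_on (Suc k) U f \<Longrightarrow> Ck_on k U f"
proof (induction k arbitrary: f)
  case 0
  then show ?case
    by (auto intro!: continuous_at_imp_continuous_on differentiable_imp_continuous_within)
qed auto

lemma Ck_on_subset: "Ck_on k U f \<Longrightarrow> V \<subseteq> U \<Longrightarrow> Ck_on k V f"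
  by (induction k arbitrary: f) (auto intro: continuous_on_subset)

section \<open>Linear, product and sum rules for derivatives\<close>

lemma frechet_derivative_bounded_linear:
  assumes "bounded_linear L" "f differentiable (at p)"
  shows "(\<lambda>q. L (f q)) differentiable (at p)"
    and "frechet_derivative (\<lambda>q. L (f q)) (at p) v = L (frechet_derivative f (at p) v)"
proof -
  have *: "((\<lambda>q. L (f q)) has_derivative (\<lambda>v. L (frechet_derivative f (at p) v))) (at p)"
    using bounded_linear.has_derivative[OF assms(1)] assms(2) frechet_derivative_works by blast
  then show "(\<lambda>q. L (f q)) differentiable (at p)"
    by (rule differentiableI)
  show "frechet_derivative (\<lambda>q. L (f q)) (at p) v = L (frechet_derivative f (at p) v)"
    using frechet_derivative_at[OF *] by metis
qed

lemma frechet_derivative_bilinear: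
  assumes "bounded_bilinear B" "f differentiable (at p)" "g differentiable (at p)"
  shows "(\<lambda>q. B (f q) (g q)) differentiable (at p)"
    and "frechet_derivative (\<lambda>q. B (f q) (g q)) (at p) v
      = B (f p) (frechet_derivative g (at p) v) + B (frechet_derivative f (at p) v) (g p)"
proof -
  have *: "((\<lambda>q. B (f q) (g q)) has_derivative (\<lambda>v.
      B (f p) (frechet_derivative g (at p) v) + B (frechet_derivative f (at p) v) (g p))) (at p)"
    using assms(2,3) by (intro bounded_bilinear.FDERIV[OF assms(1)])
      (simp_all add: frechet_derivative_works[symmetric])
  then show "(\<lambda>q. B (f q) (g q)) differentiable (at p)"
    by (rule differentiableI)
  show "frechet_derivative (\<lambda>q. B (f q) (g q)) (at p) v
      = B (f p) (frechet_derivative g (at p) v) + B (frechet_derivative f (at p) v) (g p)"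
    using frechet_derivative_at[OF *] by metis
qed

lemma frechet_derivative_add:
  assumes "f differentiable (at p)" "g differentiable (at p)"
  shows "frechet_derivative (\<lambda>q. f q + g q) (at p) v
      = frechet_derivative f (at p) v + frechet_derivative g (at p) v"
proof -
  have *: "((\<lambda>q. f q + g q) has_derivative (\<lambda>v.
      frechet_derivative f (at p) v + frechet_derivative g (at p) v)) (at p)"
    using assms by (intro has_derivative_add) (simp_all add: frechet_derivative_works[symmetric])
  show ?thesis
    using frechet_derivative_at[OF *] by metis
qed

section \<open>Closure properties of C^k and smooth functions\<close>

lemma Ck_on_add:
  assumes "open U" "Ck_on k U f" "Ck_on k U g"
  shows "Ck_on k U (\<lambda>p. f p + g p)"
  using assms(2,3)
proof (induction k arbitrary: f g)
  case 0
  then show ?case by (simp add: continuous_on_add)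
next
  case (Suc k)
  have "Ck_on k U (\<lambda>p. frechet_derivative (\<lambda>q. f q + g q) (at p) v)" for v
  proof (rule Ck_on_cong[OF assms(1)])
    show "Ck_on k U (\<lambda>p. frechet_derivative f (at p) v + frechet_derivative g (at p) v)"
      using Suc by simp
  qed (use Suc.prems in \<open>simp add: frechet_derivative_add\<close>)
  with Suc.prems show ?case by simp
qed

lemma Ck_on_bounded_linear:
  assumes "open U" "bounded_linear L" "Ck_on k U f"
  shows "Ck_on k U (\<lambda>p. L (f p))"
  using assms(3)
proof (induction k arbitrary: f)
  case 0
  then show ?case using bounded_linear.continuous_on[OF assms(2)] by simp
next
  case (Suc k)
  have "Ck_on k U (\<lambda>p. frechet_derivative (\<lambda>q. L (f q)) (at p) v)" for v
  proof (rule Ck_on_cong[OF assms(1)])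
    show "Ck_on k U (\<lambda>p. L (frechet_derivative f (at p) v))"
      using Suc by simp
  qed (use Suc.prems in \<open>simp add: frechet_derivative_bounded_linear[OF assms(2)]\<close>)
  with Suc.prems show ?case by (simp add: frechet_derivative_bounded_linear[OF assms(2)])
qed

lemma Ck_on_bilinear:
  assumes "open U" "bounded_bilinear B" "Ck_on k U f" "Ck_on k U g"
  shows "Ck_on k U (\<lambda>p. B (f p) (g p))"
  using assms(3,4)
proof (induction k arbitrary: f g)
  case 0
  then show ?case using bounded_bilinear.continuous_on[OF assms(2)] by simp
next
  case (Suc k)
  have "Ck_on k U (\<lambda>p. frechet_derivative (\<lambda>q. B (f q) (g q)) (at p) v)" for v
  proof (rule Ck_on_cong[OF assms(1)])
    show "Ck_on k U (\<lambda>p. B (f p) (frechet_derivative g (at p) v)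
        + B (frechet_derivative f (at p) v) (g p))"
      \<comment> \<open>Each Leibniz term pairs an undifferentiated factor with a derivative that is
        only C^k; lowering the first factor by one order makes the induction hypothesis fit.\<close>
      using Suc.prems by (intro Ck_on_add assms(1) Suc.IH) (auto intro: Ck_on_SucD)
  qed (use Suc.prems in \<open>simp add: frechet_derivative_bilinear[OF assms(2)]\<close>)
  with Suc.prems show ?case by (simp add: frechet_derivative_bilinear[OF assms(2)])
qed

lemma Ck_on_const: "Ck_on k U (\<lambda>p. c)"
  by (induction k arbitrary: c) (simp_all add: frechet_derivative_const)

lemma Ck_on_id: "Ck_on k U (\<lambda>p. p)"
  by (cases k) (simp_all add: frechet_derivative_ident Ck_on_const)

lemma smooth_on_subset: "smooth_on U f \<Longrightarrow> V \<subseteq> U \<Longrightarrow> smooth_on V f"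
  unfolding smooth_on_def using Ck_on_subset by blast

lemma smooth_on_imp_differentiable: "smooth_on U f \<Longrightarrow> p \<in> U \<Longrightarrow> f differentiable (at p)"
  unfolding smooth_on_def by (meson Ck_on.simps(2))

lemma smooth_on_imp_continuous_on: "smooth_on U f \<Longrightarrow> continuous_on U f"
  unfolding smooth_on_def by (meson Ck_on.simps(1))

lemma smooth_on_frechet_derivative:
  "smooth_on U f \<Longrightarrow> smooth_on U (\<lambda>p. frechet_derivative f (at p) v)"
  unfolding smooth_on_def
proof
  fix k assume "\<forall>k. Ck_on k U f"
  then have "Ck_on (Suc k) U f" by blast
  then show "Ck_on k U (\<lambda>p. frechet_derivative f (at p) v)" by simp
qed

lemma smooth_on_add:
  "open U \<Longrightarrow> smooth_on U f \<Longrightarrow> smooth_on U g \<Longrightarrow> smooth_on U (\<lambda>p. f p + g p)"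
  unfolding smooth_on_def using Ck_on_add by blast

lemma smooth_on_bounded_linear:
  "open U \<Longrightarrow> bounded_linear L \<Longrightarrow> smooth_on U f \<Longrightarrow> smooth_on U (\<lambda>p. L (f p))"
  unfolding smooth_on_def using Ck_on_bounded_linear by blast

lemma smooth_on_bilinear:
  "open U \<Longrightarrow> bounded_bilinear B \<Longrightarrow> smooth_on U f \<Longrightarrow> smooth_on U g
    \<Longrightarrow> smooth_on U (\<lambda>p. B (f p) (g p))"
  unfolding smooth_on_def using Ck_on_bilinear by blast

lemma smooth_on_const: "smooth_on U (\<lambda>p. c)"
  unfolding smooth_on_def using Ck_on_const by blast

lemma smooth_on_linear:
  assumes "open U" "bounded_linear L"
  shows "smooth_on U L"
  using smooth_on_bounded_linear[OF assms, of "\<lambda>p. p"] Ck_on_id unfolding smooth_on_def by blast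

lemmas smooth_on_mult = smooth_on_bilinear[OF _ bounded_bilinear_mult]

lemma smooth_on_diff:
  assumes "open U" "smooth_on U f" "smooth_on U g"
  shows "smooth_on U (\<lambda>p. f p - g p)"
  using smooth_on_add[OF assms(1,2)
      smooth_on_bounded_linear[OF assms(1) bounded_linear_minus[OF bounded_linear_ident] assms(3)]]
  by simp

section \<open>Symmetry of second derivatives\<close>

lemma has_real_derivative_along_line:
  fixes u :: "'a::euclidean_space \<Rightarrow> real"
  assumes "u differentiable (at (a + s *\<^sub>R v))"
  shows "((\<lambda>s. u (a + s *\<^sub>R v)) has_real_derivative frechet_derivative u (at (a + s *\<^sub>R v)) v) (at s)"
proof -
  have 1: "((\<lambda>s. a + s *\<^sub>R v) has_derivative (\<lambda>h. h *\<^sub>R v)) (at s)"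
    by (auto intro!: derivative_eq_intros)
  have 2: "(u has_derivative frechet_derivative u (at (a + s *\<^sub>R v))) (at (a + s *\<^sub>R v))"
    using assms frechet_derivative_works by blast
  have "linear (frechet_derivative u (at (a + s *\<^sub>R v)))"
    using assms by (rule linear_frechet_derivative)
  then show ?thesis
    using has_derivative_compose[OF 1 2]
    by (simp add: has_field_derivative_def linear_scale mult_commute_abs)
qed

text \<open>Two applications of the mean value theorem, first along \<open>v\<close> and then along
  \<open>w\<close>, turn the second difference over a small parallelogram into a mixed derivative.
  The second difference is symmetric in \<open>v\<close> and \<open>w\<close>, which is the source
  of the symmetry of second derivatives.\<close>

lemma second_difference_mean_value:
  fixes u :: "'a::euclidean_space \<Rightarrow> real"
  assumes d1: "\<And>q. q \<in> ball p r \<Longrightarrow> u differentiable (at q)"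
    and d2: "\<And>q. q \<in> ball p r \<Longrightarrow> (\<lambda>x. frechet_derivative u (at x) v) differentiable (at q)"
    and s: "s > 0" "s * (norm v + norm w) < r"
  shows "\<exists>q\<in>ball p r. u (p + s *\<^sub>R v + s *\<^sub>R w) - u (p + s *\<^sub>R v) - u (p + s *\<^sub>R w) + u p
    = s\<^sup>2 * frechet_derivative (\<lambda>x. frechet_derivative u (at x) v) (at q) w"
proof -
  \<comment> \<open>The whole parallelogram lies in the ball, so both mean value theorems have
    differentiability along their segments.\<close>
  have inb: "p + x *\<^sub>R v + y *\<^sub>R w \<in> ball p r" if "0 \<le> x" "x \<le> s" "0 \<le> y" "y \<le> s" for x y
  proof -
    have "dist p (p + x *\<^sub>R v + y *\<^sub>R w) = norm (x *\<^sub>R v + y *\<^sub>R w)"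
      by (metis add.assoc add_diff_cancel_left' dist_commute dist_norm)
    also have "\<dots> \<le> x * norm v + y * norm w"
      using norm_triangle_ineq[of "x *\<^sub>R v" "y *\<^sub>R w"] that by simp
    also have "\<dots> \<le> s * norm v + s * norm w"
      using that by (intro add_mono mult_right_mono) auto
    finally show ?thesis using s(2) by (simp add: algebra_simps)
  qed
  \<comment> \<open>The second difference is the increment of \<phi> over \<open>[0, s]\<close>; the
    mean value theorem leaves a difference of \<open>v\<close>-derivatives between two points that
    are \<open>s *\<^sub>R w\<close> apart.\<close>
  define \<phi> where "\<phi> x = u ((p + s *\<^sub>R w) + x *\<^sub>R v) - u (p + x *\<^sub>R v)" for x
  have "(\<phi> has_real_derivative frechet_derivative u (at (p + s *\<^sub>R w + x *\<^sub>R v)) v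
      - frechet_derivative u (at (p + x *\<^sub>R v)) v) (at x)" if "0 \<le> x" "x \<le> s" for x
    unfolding \<phi>_def
    using inb[of x s] inb[of x 0] that s(1)
    by (intro DERIV_diff has_real_derivative_along_line d1) (auto simp: algebra_simps)
  from MVT2[OF s(1) this] obtain x where x: "0 < x" "x < s" and
    eq1: "\<phi> s - \<phi> 0 = (s - 0) * (frechet_derivative u (at (p + s *\<^sub>R w + x *\<^sub>R v)) v
      - frechet_derivative u (at (p + x *\<^sub>R v)) v)" by blast
  \<comment> \<open>That remaining difference is the increment of \<psi>, the
    \<open>v\<close>-derivative of \<open>u\<close> along the segment in direction
    \<open>w\<close>.\<close>
  define \<psi> where "\<psi> y = frechet_derivative u (at ((p + x *\<^sub>R v) + y *\<^sub>R w)) v" for y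
  have "(\<psi> has_real_derivative frechet_derivative (\<lambda>x. frechet_derivative u (at x) v)
      (at ((p + x *\<^sub>R v) + y *\<^sub>R w)) w) (at y)" if "0 \<le> y" "y \<le> s" for y
    unfolding \<psi>_def
    using inb[of x y] that x
    by (intro has_real_derivative_along_line[where u = "\<lambda>x. frechet_derivative u (at x) v"] d2) auto
  from MVT2[OF s(1) this] obtain y where y: "0 < y" "y < s" and
    eq2: "\<psi> s - \<psi> 0 = (s - 0) * frechet_derivative (\<lambda>x. frechet_derivative u (at x) v)
      (at ((p + x *\<^sub>R v) + y *\<^sub>R w)) w" by blast
  show ?thesis
  proof (rule bexI)
    show "p + x *\<^sub>R v + y *\<^sub>R w \<in> ball p r" using inb x y by auto
    have "\<phi> s - \<phi> 0 = s * (\<psi> s - \<psi> 0)"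
      using eq1 by (simp add: \<psi>_def add.commute add.left_commute)
    then show "u (p + s *\<^sub>R v + s *\<^sub>R w) - u (p + s *\<^sub>R v) - u (p + s *\<^sub>R w) + u p
      = s\<^sup>2 * frechet_derivative (\<lambda>x. frechet_derivative u (at x) v) (at (p + x *\<^sub>R v + y *\<^sub>R w)) w"
      using eq2 by (simp add: \<phi>_def power2_eq_square algebra_simps)
  qed
qed

text \<open>The two mixed derivatives take a common value at points \<open>q1\<close> and
  \<open>q2\<close> as close to \<open>p\<close> as desired, and both are continuous at
  \<open>p\<close>.\<close>

lemma frechet_derivative_commute_real:
  fixes u :: "'a::euclidean_space \<Rightarrow> real"
  assumes U: "open U" "p \<in> U" and u: "Ck_on 2 U u"
  shows "frechet_derivative (\<lambda>x. frechet_derivative u (at x) v) (at p) w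
    = frechet_derivative (\<lambda>x. frechet_derivative u (at x) w) (at p) v"
proof -
  define A where "A v w q = frechet_derivative (\<lambda>x. frechet_derivative u (at x) v) (at q) w"
    for v w q
  have d1: "u differentiable (at q)" if "q \<in> U" for q
    using u that by (simp add: numeral_2_eq_2)
  have d2: "(\<lambda>x. frechet_derivative u (at x) v) differentiable (at q)" if "q \<in> U" for q v
    using u that by (simp add: numeral_2_eq_2)
  have cont: "isCont (A v w) p" for v w
  proof -
    have "continuous_on U (A v w)" using u by (simp add: A_def numeral_2_eq_2)
    then show ?thesis using U by (simp add: continuous_on_eq_continuous_at)
  qed
  have "\<bar>A v w p - A w v p\<bar> < e" if e: "e > 0" for e
  proof -
    obtain r0 where r0: "r0 > 0" "ball p r0 \<subseteq> U" using U open_contains_ball by blast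
    obtain r1 where r1: "r1 > 0" "\<And>q. dist q p < r1 \<Longrightarrow> dist (A v w q) (A v w p) < e / 2"
      using cont[of v w] e unfolding continuous_at_eps_delta by (meson half_gt_zero)
    obtain r2 where r2: "r2 > 0" "\<And>q. dist q p < r2 \<Longrightarrow> dist (A w v q) (A w v p) < e / 2"
      using cont[of w v] e unfolding continuous_at_eps_delta by (meson half_gt_zero)
    define r where "r = min r0 (min r1 r2)"
    \<comment> \<open>The summand 1 keeps the denominator positive when \<open>v\<close> and
      \<open>w\<close> are both zero and makes the bound \<open>sr\<close> strict.\<close>
    define s where "s = r / (norm v + norm w + 1)"
    have r: "r > 0" using r0 r1 r2 by (simp add: r_def)
    have n: "norm v + norm w + 1 > 0" by (simp add: add_nonneg_pos)
    have s: "s > 0" using r n by (simp add: s_def)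
    have "s * (norm v + norm w + 1) = r" using n by (simp add: s_def)
    then have sr: "s * (norm v + norm w) < r" using s by (simp add: algebra_simps)
    have bU: "q \<in> U" if "q \<in> ball p r" for q using that r0 by (auto simp: r_def)
    obtain q1 where q1: "q1 \<in> ball p r"
      "u (p + s *\<^sub>R v + s *\<^sub>R w) - u (p + s *\<^sub>R v) - u (p + s *\<^sub>R w) + u p = s\<^sup>2 * A v w q1"
      using second_difference_mean_value[of p r u v s w, OF d1 d2 s sr] bU unfolding A_def by blast
    obtain q2 where q2: "q2 \<in> ball p r"
      "u (p + s *\<^sub>R w + s *\<^sub>R v) - u (p + s *\<^sub>R w) - u (p + s *\<^sub>R v) + u p = s\<^sup>2 * A w v q2"
      using second_difference_mean_value[of p r u w s v, OF d1 d2 s] sr bU unfolding A_def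
      by (auto simp: add.commute)
    have "s\<^sup>2 * A v w q1 = s\<^sup>2 * A w v q2"
      using q1(2) q2(2) by (simp add: algebra_simps)
    then have "A v w q1 = A w v q2" using s by simp
    moreover have "dist (A v w q1) (A v w p) < e / 2"
      using q1(1) by (intro r1) (simp add: r_def dist_commute)
    moreover have "dist (A w v q2) (A w v p) < e / 2"
      using q2(1) by (intro r2) (simp add: r_def dist_commute)
    ultimately show ?thesis unfolding dist_real_def by linarith
  qed
  then have "A v w p = A w v p"
    by (metis abs_le_zero_iff dense_ge eq_iff_diff_eq_0 less_imp_le)
  then show ?thesis by (simp add: A_def)
qed

text \<open>The mean value argument is scalar, so the vector-valued case is reduced to the
  components of \<open>u\<close> along basis vectors.\<close>

lemma frechet_derivative_commute:
  fixes u :: "'a::euclidean_space \<Rightarrow> 'b::euclidean_space"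
  assumes U: "open U" "p \<in> U" and u: "Ck_on 2 U u"
  shows "frechet_derivative (\<lambda>x. frechet_derivative u (at x) v) (at p) w
    = frechet_derivative (\<lambda>x. frechet_derivative u (at x) w) (at p) v"
proof (rule euclidean_eqI)
  fix b :: 'b
  have L: "bounded_linear (\<lambda>y::'b. y \<bullet> b)" by (rule bounded_linear_inner_left)
  have comp: "frechet_derivative (\<lambda>x. frechet_derivative u (at x) v) (at p) w \<bullet> b
      = frechet_derivative (\<lambda>x. frechet_derivative (\<lambda>y. u y \<bullet> b) (at x) v) (at p) w" for v w
  proof -
    have "frechet_derivative (\<lambda>x. frechet_derivative (\<lambda>y. u y \<bullet> b) (at x) v) (at p)
        = frechet_derivative (\<lambda>x. frechet_derivative u (at x) v \<bullet> b) (at p)"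
      using u by (intro frechet_derivative_cong_open[OF U] frechet_derivative_bounded_linear[OF L])
        (simp add: numeral_2_eq_2)
    then show ?thesis
      using u U(2) by (simp add: frechet_derivative_bounded_linear[OF L] numeral_2_eq_2)
  qed
  show "frechet_derivative (\<lambda>x. frechet_derivative u (at x) v) (at p) w \<bullet> b
      = frechet_derivative (\<lambda>x. frechet_derivative u (at x) w) (at p) v \<bullet> b"
    unfolding comp
    by (rule frechet_derivative_commute_real[OF U]) (rule Ck_on_bounded_linear[OF U(1) L u])
qed

section \<open>The complex horizontal fields\<close>

definition Zbar :: "(heis \<Rightarrow> complex) \<Rightarrow> heis \<Rightarrow> complex" where
  "Zbar u p = (1/2) * (Xf u p + \<i> * Yf u p)"

text \<open>The coefficients 2y and -2x combine to y + ix = i(x - iy). The coefficient of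
  \<open>Dt\<close> is thus real-linear in the point and easy to differentiate again.\<close>

lemma Zf_eq: "Zf u p = (1/2) * (Dx u p - \<i> * Dy u p) + \<i> * cnj (fst p) * Dt u p"
  by (simp add: Zf_def Xf_def Yf_def complex_eq_iff algebra_simps)

lemma Zbar_eq: "Zbar u p = (1/2) * (Dx u p + \<i> * Dy u p) - \<i> * fst p * Dt u p"
  by (simp add: Zbar_def Xf_def Yf_def complex_eq_iff algebra_simps)

text \<open>This is what permits differentiating an identity known only on an open set.\<close>

lemma horizontal_cong_open:
  assumes "open U" "p \<in> U" "\<And>q. q \<in> U \<Longrightarrow> u q = w q"
  shows "Zf u p = Zf w p" "Zbar u p = Zbar w p" "Dt u p = Dt w p"
  using frechet_derivative_cong_open[OF assms]
  by (simp_all add: Zf_eq Zbar_eq Dx_def Dy_def Dt_def)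

lemma horizontal_const: "Zf (\<lambda>q. c) p = 0" "Zbar (\<lambda>q. c) p = 0" "Dt (\<lambda>q. c) p = 0"
  by (simp_all add: Zf_eq Zbar_eq Dx_def Dy_def Dt_def frechet_derivative_const)

lemma horizontal_mult:
  assumes "u differentiable (at p)" "w differentiable (at p)"
  shows "Zf (\<lambda>q. u q * w q) p = Zf u p * w p + u p * Zf w p"
    "Zbar (\<lambda>q. u q * w q) p = Zbar u p * w p + u p * Zbar w p"
    "Dt (\<lambda>q. u q * w q) p = Dt u p * w p + u p * Dt w p"
  by (simp_all add: Zf_eq Zbar_eq Dx_def Dy_def Dt_def algebra_simps
      frechet_derivative_bilinear[OF bounded_bilinear_mult assms])

lemma horizontal_cmult:
  assumes "u differentiable (at p)"
  shows "Zf (\<lambda>q. c * u q) p = c * Zf u p"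
    "Zbar (\<lambda>q. c * u q) p = c * Zbar u p"
    "Dt (\<lambda>q. c * u q) p = c * Dt u p"
  using horizontal_mult[OF differentiable_const assms, of c] by (simp_all add: horizontal_const)

lemma horizontal_add:
  assumes "u differentiable (at p)" "w differentiable (at p)"
  shows "Zf (\<lambda>q. u q + w q) p = Zf u p + Zf w p"
    "Zbar (\<lambda>q. u q + w q) p = Zbar u p + Zbar w p"
    "Dt (\<lambda>q. u q + w q) p = Dt u p + Dt w p"
  by (simp_all add: Zf_eq Zbar_eq Dx_def Dy_def Dt_def algebra_simps frechet_derivative_add[OF assms])

text \<open>The fields X and Y are real, so conjugation changes only the sign of \<open>\<i>\<close>
  and exchanges \<open>Zf\<close> with \<open>Zbar\<close>.\<close>

lemma horizontal_cnj:
  assumes "u differentiable (at p)"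
  shows "Zf (\<lambda>q. cnj (u q)) p = cnj (Zbar u p)"
    "Zbar (\<lambda>q. cnj (u q)) p = cnj (Zf u p)"
    "Dt (\<lambda>q. cnj (u q)) p = cnj (Dt u p)"
  by (simp_all add: Zf_eq Zbar_eq Dx_def Dy_def Dt_def algebra_simps
      frechet_derivative_bounded_linear[OF bounded_linear_cnj assms])

section \<open>Regularity, second derivatives and commutators\<close>

lemma smooth_on_Dx: "smooth_on U u \<Longrightarrow> smooth_on U (Dx u)"
  and smooth_on_Dy: "smooth_on U u \<Longrightarrow> smooth_on U (Dy u)"
  and smooth_on_Dt: "smooth_on U u \<Longrightarrow> smooth_on U (Dt u)"
  unfolding Dx_def[abs_def] Dy_def[abs_def] Dt_def[abs_def] by (simp_all add: smooth_on_frechet_derivative)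

lemma smooth_on_Zf:
  assumes "open U" "smooth_on U u"
  shows "smooth_on U (Zf u)"
proof -
  have "smooth_on U (\<lambda>p::heis. cnj (fst p))"
    by (rule smooth_on_bounded_linear[OF assms(1) bounded_linear_cnj
          smooth_on_linear[OF assms(1) bounded_linear_fst]])
  then show ?thesis
    unfolding Zf_eq[abs_def]
    using assms by (intro smooth_on_add smooth_on_diff smooth_on_mult smooth_on_const
        smooth_on_Dx smooth_on_Dy smooth_on_Dt)
qed

lemma smooth_on_Zbar:
  assumes "open U" "smooth_on U u"
  shows "smooth_on U (Zbar u)"
  unfolding Zbar_eq[abs_def]
  using assms by (intro smooth_on_add smooth_on_diff smooth_on_mult smooth_on_const
      smooth_on_linear[OF assms(1) bounded_linear_fst] smooth_on_Dx smooth_on_Dy smooth_on_Dt)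

text \<open>The last term comes from differentiating the coefficient
  \<open>\<i> * cnj (fst p)\<close>; such terms are all that survives in the commutator.\<close>

lemma frechet_derivative_Zf:
  assumes "smooth_on U u" "p \<in> U"
  shows "frechet_derivative (Zf u) (at p) v
    = (1/2) * (frechet_derivative (Dx u) (at p) v - \<i> * frechet_derivative (Dy u) (at p) v)
      + \<i> * cnj (fst p) * frechet_derivative (Dt u) (at p) v + \<i> * cnj (fst v) * Dt u p"
proof -
  have D: "(Dx u has_derivative frechet_derivative (Dx u) (at p)) (at p)"
    "(Dy u has_derivative frechet_derivative (Dy u) (at p)) (at p)"
    "(Dt u has_derivative frechet_derivative (Dt u) (at p)) (at p)"
    unfolding frechet_derivative_works[symmetric]
    by (rule smooth_on_imp_differentiable[OF _ assms(2)],
        rule smooth_on_Dx[OF assms(1)] smooth_on_Dy[OF assms(1)] smooth_on_Dt[OF assms(1)])+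
  have C: "((\<lambda>p::heis. \<i> * cnj (fst p)) has_derivative (\<lambda>v. \<i> * cnj (fst v))) (at p)"
    by (intro bounded_linear_imp_has_derivative bounded_linear_const_mult
        bounded_linear_compose[OF bounded_linear_cnj] bounded_linear_fst)
  have "(Zf u has_derivative (\<lambda>v. (1/2) * (frechet_derivative (Dx u) (at p) v
        - \<i> * frechet_derivative (Dy u) (at p) v)
      + (\<i> * cnj (fst p) * frechet_derivative (Dt u) (at p) v + \<i> * cnj (fst v) * Dt u p))) (at p)"
    unfolding Zf_eq[abs_def]
    by (rule has_derivative_add[OF has_derivative_mult_right[OF has_derivative_diff[OF D(1)
            has_derivative_mult_right[OF D(2)]]] has_derivative_mult[OF C D(3)]])
  from fun_cong[OF frechet_derivative_at[OF this, symmetric], of v] show ?thesis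
    by (simp only: add.assoc)
qed

lemma frechet_derivative_Zbar:
  assumes "smooth_on U u" "p \<in> U"
  shows "frechet_derivative (Zbar u) (at p) v
    = (1/2) * (frechet_derivative (Dx u) (at p) v + \<i> * frechet_derivative (Dy u) (at p) v)
      - \<i> * fst p * frechet_derivative (Dt u) (at p) v - \<i> * fst v * Dt u p"
proof -
  have D: "(Dx u has_derivative frechet_derivative (Dx u) (at p)) (at p)"
    "(Dy u has_derivative frechet_derivative (Dy u) (at p)) (at p)"
    "(Dt u has_derivative frechet_derivative (Dt u) (at p)) (at p)"
    unfolding frechet_derivative_works[symmetric]
    by (rule smooth_on_imp_differentiable[OF _ assms(2)],
        rule smooth_on_Dx[OF assms(1)] smooth_on_Dy[OF assms(1)] smooth_on_Dt[OF assms(1)])+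
  have C: "((\<lambda>p::heis. \<i> * fst p) has_derivative (\<lambda>v. \<i> * fst v)) (at p)"
    by (intro bounded_linear_imp_has_derivative bounded_linear_const_mult bounded_linear_fst)
  have "(Zbar u has_derivative (\<lambda>v. (1/2) * (frechet_derivative (Dx u) (at p) v
        + \<i> * frechet_derivative (Dy u) (at p) v)
      - (\<i> * fst p * frechet_derivative (Dt u) (at p) v + \<i> * fst v * Dt u p))) (at p)"
    unfolding Zbar_eq[abs_def]
    by (rule has_derivative_diff[OF has_derivative_mult_right[OF has_derivative_add[OF D(1)
            has_derivative_mult_right[OF D(2)]]] has_derivative_mult[OF C D(3)]])
  from fun_cong[OF frechet_derivative_at[OF this, symmetric], of v] show ?thesis
    by (simp only: diff_diff_eq)
qed

lemma second_derivatives_commute: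
  fixes u :: "heis \<Rightarrow> 'b::euclidean_space"
  assumes "open U" "smooth_on U u" "p \<in> U"
  shows "Dy (Dx u) p = Dx (Dy u) p" "Dt (Dx u) p = Dx (Dt u) p" "Dt (Dy u) p = Dy (Dt u) p"
  using assms(2) unfolding smooth_on_def Dx_def[abs_def] Dy_def[abs_def] Dt_def[abs_def]
  by (intro frechet_derivative_commute[OF assms(1,3)]; simp)+

text \<open>Second-order terms cancel by symmetry. Differentiating the \<open>Dt\<close>
  coefficients gives -i from \<open>Zf\<close> acting on \<open>- \<i> * fst p\<close> and i from
  \<open>Zbar\<close> acting on \<open>\<i> * cnj (fst p)\<close>; their difference is -2i.\<close>

lemma Zf_Zbar_commutator:
  assumes "open U" "smooth_on U u" "p \<in> U"
  shows "Zf (Zbar u) p = Zbar (Zf u) p - 2 * \<i> * Dt u p"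
  unfolding Zf_eq[of "Zbar u"] Zbar_eq[of "Zf u"]
    Dx_def[of "Zf u"] Dy_def[of "Zf u"] Dt_def[of "Zf u"]
    Dx_def[of "Zbar u"] Dy_def[of "Zbar u"] Dt_def[of "Zbar u"]
    frechet_derivative_Zf[OF assms(2,3)] frechet_derivative_Zbar[OF assms(2,3)]
  by (simp add: second_derivatives_commute[OF assms] algebra_simps
      flip: Dx_def Dy_def Dt_def)

text \<open>The coefficients of \<open>Zf\<close> do not depend on t: the extra term of
  \<open>frechet_derivative_Zf\<close> vanishes for a vertical direction.\<close>

lemma Dt_Zf_commute:
  assumes "open U" "smooth_on U u" "p \<in> U"
  shows "Dt (Zf u) p = Zf (Dt u) p"
  unfolding Zf_eq[of "Dt u"] Dt_def[of "Zf u"] frechet_derivative_Zf[OF assms(2,3)]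
  by (simp add: second_derivatives_commute[OF assms] algebra_simps
      flip: Dx_def Dy_def Dt_def)

text \<open>As a single direction, X is a vector in the kernel of \<open>contact_form\<close>, to
  which the contact condition can be applied directly.\<close>

lemma Xf_eq_frechet_derivative:
  assumes "u differentiable (at p)"
  shows "Xf u p = frechet_derivative u (at p) (1, 2 * Im (fst p))"
proof -
  have l: "linear (frechet_derivative u (at p))" using assms by (rule linear_frechet_derivative)
  have "(1, 2 * Im (fst p)) = ((1, 0) :: heis) + (2 * Im (fst p)) *\<^sub>R (0, 1)" by simp
  then show ?thesis by (simp only: Xf_def Dx_def Dt_def linear_add[OF l] linear_scale[OF l])
qed

lemma Yf_eq_frechet_derivative:
  assumes "u differentiable (at p)"
  shows "Yf u p = frechet_derivative u (at p) (\<i>, - 2 * Re (fst p))"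
proof -
  have l: "linear (frechet_derivative u (at p))" using assms by (rule linear_frechet_derivative)
  have "(\<i>, - 2 * Re (fst p)) = ((\<i>, 0) :: heis) - (2 * Re (fst p)) *\<^sub>R (0, 1)" by simp
  then show ?thesis by (simp only: Yf_def Dy_def Dt_def linear_diff[OF l] linear_scale[OF l])
qed

section \<open>Conformal maps\<close>

text \<open>The product is a quarter of (XF)^2 + (YF)^2. Conformality makes XF and YF orthogonal
  plane vectors of equal length, so YF is iXF or -iXF and the squares cancel.\<close>

lemma conformal_map_on_Zf_Zbar:
  assumes "conformal_map_on U f" "p \<in> U" "f differentiable (at p)"
  shows "Zf (\<lambda>q. fst (f q)) p * Zbar (\<lambda>q. fst (f q)) p = 0"
proof -
  let ?F = "\<lambda>q. fst (f q)"
  have F: "?F differentiable (at p)"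
    by (rule frechet_derivative_bounded_linear[OF bounded_linear_fst assms(3)])
  have re: "Xf (\<lambda>q. Re (?F q)) p = Re (Xf ?F p)" "Yf (\<lambda>q. Re (?F q)) p = Re (Yf ?F p)"
    and im: "Xf (\<lambda>q. Im (?F q)) p = Im (Xf ?F p)" "Yf (\<lambda>q. Im (?F q)) p = Im (Yf ?F p)"
    using F by (simp_all add: Xf_def Yf_def Dx_def Dy_def Dt_def
        frechet_derivative_bounded_linear[OF bounded_linear_Re F]
        frechet_derivative_bounded_linear[OF bounded_linear_Im F])
  have conf: "(Re (Xf ?F p))\<^sup>2 + (Im (Xf ?F p))\<^sup>2 = (Re (Yf ?F p))\<^sup>2 + (Im (Yf ?F p))\<^sup>2"
    "Re (Xf ?F p) * Re (Yf ?F p) + Im (Xf ?F p) * Im (Yf ?F p) = 0"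
    unfolding re[symmetric] im[symmetric]
    using assms(1,2) unfolding conformal_map_on_def Let_def by blast+
  have "Zf ?F p * Zbar ?F p = (1/4) * ((Xf ?F p)\<^sup>2 + (Yf ?F p)\<^sup>2)"
    by (simp add: Zf_def Zbar_def algebra_simps power2_eq_square)
  also have "(Xf ?F p)\<^sup>2 + (Yf ?F p)\<^sup>2 = 0"
  proof -
    have norms: "Xf ?F p * cnj (Xf ?F p) = Yf ?F p * cnj (Yf ?F p)"
      using conf(1) by (simp add: complex_mult_cnj)
    have orth: "Xf ?F p * cnj (Yf ?F p) = - cnj (Xf ?F p) * Yf ?F p"
      using conf(2) by (simp add: complex_eq_iff algebra_simps)
    \<comment> \<open>After multiplication by \<open>cnj (Yf ?F p)\<close> both relations can be
      substituted. If this factor is zero, \<open>norms\<close> forces \<open>Xf ?F p\<close> to be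
      zero as well.\<close>
    have "((Xf ?F p)\<^sup>2 + (Yf ?F p)\<^sup>2) * cnj (Yf ?F p)
        = Xf ?F p * (Xf ?F p * cnj (Yf ?F p)) + Yf ?F p * (Yf ?F p * cnj (Yf ?F p))"
      by (simp add: algebra_simps power2_eq_square)
    also have "\<dots> = 0"
      unfolding orth norms[symmetric] by (simp add: algebra_simps)
    finally show ?thesis
      using norms by auto
  qed
  finally show ?thesis by simp
qed

text \<open>A vector annihilated by the contact form is sent to one annihilated at the image point,
  which gives df_3 = 2(f_2 df_1 - f_1 df_2) on it. The right side is i(\<open>Fb\<close> dF - F
  d\<open>Fb\<close>), and combining the X and Y directions gives \<open>Zf\<close> and
  \<open>Zbar\<close>.\<close>

lemma contact_map_on_horizontal:
  assumes "contact_map_on U f" "p \<in> U" "f differentiable (at p)"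
  defines "F \<equiv> \<lambda>q. fst (f q)" and "Fb \<equiv> \<lambda>q. cnj (fst (f q))"
    and "g \<equiv> \<lambda>q. complex_of_real (snd (f q))"
  shows "Zf g p = \<i> * (Fb p * Zf F p - F p * Zf Fb p)"
    and "Zbar g p = \<i> * (Fb p * Zbar F p - F p * Zbar Fb p)"
proof -
  have dF: "F differentiable (at p)"
    and DF: "\<And>v. frechet_derivative F (at p) v = fst (frechet_derivative f (at p) v)"
    unfolding F_def using frechet_derivative_bounded_linear[OF bounded_linear_fst assms(3)] by auto
  have dFb: "Fb differentiable (at p)"
    and DFb: "\<And>v. frechet_derivative Fb (at p) v = cnj (fst (frechet_derivative f (at p) v))"
    unfolding Fb_def using frechet_derivative_bounded_linear[OF bounded_linear_compose[OF
          bounded_linear_cnj bounded_linear_fst] assms(3)] by auto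
  have dg: "g differentiable (at p)"
    and Dg: "\<And>v. frechet_derivative g (at p) v = of_real (snd (frechet_derivative f (at p) v))"
    unfolding g_def using frechet_derivative_bounded_linear[OF bounded_linear_compose[OF
          bounded_linear_of_real bounded_linear_snd] assms(3)] by auto
  obtain l where l: "pullback_form f contact_form p v = l * contact_form p v" for v
    using assms(1,2) unfolding contact_map_on_def by blast
  have contact: "frechet_derivative g (at p) v
      = \<i> * (Fb p * frechet_derivative F (at p) v - F p * frechet_derivative Fb (at p) v)"
    if "contact_form p v = 0" for v
  proof -
    have "snd (frechet_derivative f (at p) v) = 2 * Im (fst (f p)) * Re (fst (frechet_derivative f (at p) v))
        - 2 * Re (fst (f p)) * Im (fst (frechet_derivative f (at p) v))"
      using l[of v] that by (simp add: pullback_form_def contact_form_def)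
    then show ?thesis
      unfolding DF DFb Dg by (simp add: F_def Fb_def complex_eq_iff algebra_simps)
  qed
  have Xg: "Xf g p = \<i> * (Fb p * Xf F p - F p * Xf Fb p)"
    unfolding Xf_eq_frechet_derivative[OF dF] Xf_eq_frechet_derivative[OF dFb]
      Xf_eq_frechet_derivative[OF dg]
    by (rule contact) (simp add: contact_form_def)
  have Yg: "Yf g p = \<i> * (Fb p * Yf F p - F p * Yf Fb p)"
    unfolding Yf_eq_frechet_derivative[OF dF] Yf_eq_frechet_derivative[OF dFb]
      Yf_eq_frechet_derivative[OF dg]
    by (rule contact) (simp add: contact_form_def)
  show "Zf g p = \<i> * (Fb p * Zf F p - F p * Zf Fb p)"
    and "Zbar g p = \<i> * (Fb p * Zbar F p - F p * Zbar Fb p)"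
    unfolding Zf_def Zbar_def Xg Yg by (simp_all add: field_simps)
qed

text \<open>The hypotheses on \<open>g\<close> are the complex contact equations after
  \<open>Zbar F = 0\<close>, with its conjugate, has removed one term from each. The equations are
  required on an open set because they get differentiated.\<close>

lemma CR_contact_Zf_third_order:
  fixes F :: "heis \<Rightarrow> complex"
  defines "Fb \<equiv> \<lambda>q. cnj (F q)"
  assumes N: "open N" and F: "smooth_on N F" and g: "smooth_on N g"
    and ZbF: "\<And>q. q \<in> N \<Longrightarrow> Zbar F q = 0"
    and Zg: "\<And>q. q \<in> N \<Longrightarrow> Zf g q = \<i> * (Fb q * Zf F q)"
    and Zbg: "\<And>q. q \<in> N \<Longrightarrow> Zbar g q = - \<i> * (F q * Zbar Fb q)"
    and nz: "\<And>q. q \<in> N \<Longrightarrow> Zf F q \<noteq> 0"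
    and p: "p \<in> N"
  shows "2 * Zf F p * Zf (Zf (Zf F)) p = 3 * (Zf (Zf F) p)\<^sup>2"
proof -
  define h k where "h = Zf F" and "k = Zbar Fb"
  have Fb: "smooth_on N Fb"
    unfolding Fb_def by (rule smooth_on_bounded_linear[OF N bounded_linear_cnj F])
  have h: "smooth_on N h" and k: "smooth_on N k"
    unfolding h_def k_def using N F Fb by (auto intro: smooth_on_Zf smooth_on_Zbar)
  note smooth = F Fb h k g smooth_on_Zf[OF N h] smooth_on_Zf[OF N k] smooth_on_Dt[OF F] smooth_on_Dt[OF Fb]
  note diff = smooth[THEN smooth_on_imp_differentiable]
  have k_eq: "k q = cnj (h q)" if "q \<in> N" for q
    unfolding k_def h_def Fb_def using that by (simp add: horizontal_cnj diff)
  have ZFb: "Zf Fb q = 0" if "q \<in> N" for q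
    unfolding Fb_def using that by (simp add: horizontal_cnj diff ZbF)
  \<comment> \<open>In this and the next two facts, one side of a commutation rule differentiates a
    function that vanishes on all of \<open>N\<close>.\<close>
  have Zbh: "Zbar h q = 2 * \<i> * Dt F q" if "q \<in> N" for q
    using Zf_Zbar_commutator[OF N F that] horizontal_cong_open(1)[OF N that, of "Zbar F" "\<lambda>q. 0"] ZbF
    by (simp add: h_def horizontal_const)
  have Zk: "Zf k q = - 2 * \<i> * Dt Fb q" if "q \<in> N" for q
    using Zf_Zbar_commutator[OF N Fb that] horizontal_cong_open(2)[OF N that, of "Zf Fb" "\<lambda>q. 0"] ZFb
    by (simp add: k_def horizontal_const)
  have ZDtFb: "Zf (Dt Fb) q = 0" if "q \<in> N" for q
    using Dt_Zf_commute[OF N Fb that] horizontal_cong_open(3)[OF N that, of "Zf Fb" "\<lambda>q. 0"] ZFb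
    by (simp add: horizontal_const)
  have ZZk: "Zf (Zf k) q = 0" if "q \<in> N" for q
  proof -
    have "Zf (Zf k) q = Zf (\<lambda>q. - 2 * \<i> * Dt Fb q) q"
      by (rule horizontal_cong_open[OF N that Zk])
    then show ?thesis
      using that by (simp only: horizontal_cmult diff ZDtFb mult_zero_right)
  qed
  \<comment> \<open>This solves the commutator relation for \<open>Dt g\<close>. The difference is
    written with \<open>(- 1)\<close> so that the rules for sums and constant multiples cover
    it.\<close>
  have Dtg: "Dt g q = h q * k q + \<i> * (Fb q * Dt F q + (- 1) * (F q * Dt Fb q))" if "q \<in> N" for q
  proof -
    have "Zf (Zbar g) q = Zf (\<lambda>q. - \<i> * (F q * k q)) q"
      using Zbg by (intro horizontal_cong_open[OF N that]) (simp add: k_def)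
    also have "\<dots> = - \<i> * (h q * k q + F q * Zf k q)"
      using that by (simp only: horizontal_cmult horizontal_mult diff differentiable_mult h_def)
    finally have 1: "Zf (Zbar g) q = - \<i> * (h q * k q + F q * (- 2 * \<i> * Dt Fb q))"
      using Zk[OF that] by simp
    have "Zbar (Zf g) q = Zbar (\<lambda>q. \<i> * (Fb q * h q)) q"
      using Zg by (intro horizontal_cong_open[OF N that]) (simp add: h_def)
    also have "\<dots> = \<i> * (k q * h q + Fb q * Zbar h q)"
      using that by (simp only: horizontal_cmult horizontal_mult diff differentiable_mult k_def)
    finally have 2: "Zbar (Zf g) q = \<i> * (k q * h q + Fb q * (2 * \<i> * Dt F q))"
      using Zbh[OF that] by simp
    have "2 * \<i> * Dt g q = Zbar (Zf g) q - Zf (Zbar g) q"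
      using Zf_Zbar_commutator[OF N g that] by simp
    then have "2 * \<i> * Dt g q
        = 2 * \<i> * (h q * k q + \<i> * (Fb q * Dt F q + (- 1) * (F q * Dt Fb q)))"
      unfolding 1 2 by (simp add: algebra_simps)
    then show ?thesis by simp
  qed
  \<comment> \<open>In the two expressions for \<open>Zf (Dt g)\<close> the terms
    \<open>Fb q * Zf (Dt F) q\<close> cancel. The \<open>Dt Fb\<close> terms add up to another
    \<open>h q * Zf k q\<close>, whence the factor 2.\<close>
  have E: "2 * (h q * Zf k q) + k q * Zf h q = 0" if "q \<in> N" for q
  proof -
    have "Zf (Dt g) q = Zf (\<lambda>q. h q * k q + \<i> * (Fb q * Dt F q + (- 1) * (F q * Dt Fb q))) q"
      by (rule horizontal_cong_open[OF N that Dtg])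
    also have "\<dots> = Zf h q * k q + h q * Zf k q
        + \<i> * (Fb q * Zf (Dt F) q + (- 1) * (h q * Dt Fb q))"
      using that by (simp only: horizontal_cmult horizontal_mult horizontal_add diff
          differentiable_mult differentiable_add differentiable_const ZFb ZDtFb h_def[symmetric]
          mult_zero_left mult_zero_right add_0_left add_0_right)
    finally have 1: "Zf (Dt g) q = Zf h q * k q + h q * Zf k q
        + \<i> * (Fb q * Zf (Dt F) q - h q * Dt Fb q)" by simp
    have "Dt (Zf g) q = Dt (\<lambda>q. \<i> * (Fb q * h q)) q"
      using Zg by (intro horizontal_cong_open[OF N that]) (simp add: h_def)
    also have "\<dots> = \<i> * (Dt Fb q * h q + Fb q * Dt h q)"
      using that by (simp only: horizontal_cmult horizontal_mult diff differentiable_mult)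
    finally have 2: "Dt (Zf g) q = \<i> * (Dt Fb q * h q + Fb q * Zf (Dt F) q)"
      using Dt_Zf_commute[OF N F that] by (simp add: h_def)
    show ?thesis
      using Dt_Zf_commute[OF N g that] Zk[OF that] unfolding 1 2 by (simp add: algebra_simps)
  qed
  have "Zf (\<lambda>q. 2 * (h q * Zf k q) + k q * Zf h q) p = 0"
    using horizontal_cong_open(1)[OF N p E] by (simp add: horizontal_const)
  \<comment> \<open>The 3 collects 2 from differentiating \<open>h\<close> in the first term of
    \<open>E\<close> and 1 from differentiating \<open>k\<close> in the second.\<close>
  then have E': "3 * (Zf h p * Zf k p) + k p * Zf (Zf h) p = 0"
    using p by (simp add: horizontal_const horizontal_mult horizontal_add diff ZZk algebra_simps)
  \<comment> \<open>Multiplying by \<open>k p\<close> allows \<open>Zf k p\<close> to be eliminated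
    between \<open>E'\<close> and \<open>E\<close>; the factor is cancelled at the end, being the
    conjugate of a nonzero number.\<close>
  have "k p * (2 * h p * Zf (Zf h) p) = 2 * h p * (k p * Zf (Zf h) p)" by simp
  also have "k p * Zf (Zf h) p = - 3 * (Zf h p * Zf k p)"
    using E' by (simp add: eq_neg_iff_add_eq_0 add.commute)
  also have "2 * h p * (- 3 * (Zf h p * Zf k p)) = - 3 * Zf h p * (2 * (h p * Zf k p))" by simp
  also have "2 * (h p * Zf k p) = - (k p * Zf h p)"
    using E[OF p] by (simp add: eq_neg_iff_add_eq_0)
  finally have "k p * (2 * h p * Zf (Zf h) p) = k p * (3 * (Zf h p)\<^sup>2)"
    by (simp add: power2_eq_square algebra_simps)
  moreover have "k p \<noteq> 0" using nz[OF p] k_eq[OF p] by (simp add: h_def)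
  ultimately show ?thesis by (simp add: h_def)
qed

theorem theorem6p1:
  fixes U :: "heis set" and f :: "heis \<Rightarrow> heis"
  assumes "open U"
    and "conformal_map_on U f"
  shows "\<forall>p\<in>U. Zf (\<lambda>q. fst (f q)) p \<noteq> 0 \<longrightarrow> S_CL f p = 0"
proof (intro ballI impI)
  fix p
  define F where "F = (\<lambda>q. fst (f q))"
  define g where "g = (\<lambda>q. complex_of_real (snd (f q)))"
  assume p: "p \<in> U" and nz: "Zf (\<lambda>q. fst (f q)) p \<noteq> 0"
  have contact: "contact_map_on U f" using assms(2) by (simp add: conformal_map_on_def)
  obtain V where V: "p \<in> V" "V \<subseteq> U" "open V" "smooth_on V f"
    using contact p unfolding contact_map_on_def local_diffeomorphism_on_def
      diffeomorphism_between_def by meson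
  have F: "smooth_on V F"
    unfolding F_def by (rule smooth_on_bounded_linear[OF V(3) bounded_linear_fst V(4)])
  have g: "smooth_on V g"
    unfolding g_def by (rule smooth_on_bounded_linear[OF V(3) bounded_linear_compose[OF
            bounded_linear_of_real bounded_linear_snd] V(4)])
  \<comment> \<open>On \<open>N\<close> the product identity from conformality singles out
    \<open>Zbar F = 0\<close>, and \<open>N\<close> is open because \<open>Zf F\<close> is
    continuous.\<close>
  define N where "N = V \<inter> Zf F -` (- {0})"
  have N: "open N"
    unfolding N_def using smooth_on_imp_continuous_on[OF smooth_on_Zf[OF V(3) F]] V(3)
    by (rule continuous_open_preimage) (simp add: open_Compl)
  have pN: "p \<in> N" using V(1) nz by (simp add: N_def F_def)
  have fN: "q \<in> U" "f differentiable (at q)" "F differentiable (at q)" "Zf F q \<noteq> 0" if "q \<in> N" for q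
    using that V F smooth_on_imp_differentiable by (auto simp: N_def)
  have ZbF: "Zbar F q = 0" if "q \<in> N" for q
    using conformal_map_on_Zf_Zbar[OF assms(2) fN(1,2)[OF that]] fN(4)[OF that]
    by (simp add: F_def)
  have "2 * Zf F p * Zf (Zf (Zf F)) p = 3 * (Zf (Zf F) p)\<^sup>2"
  proof (rule CR_contact_Zf_third_order[OF N, of F g])
    show "smooth_on N F" "smooth_on N g"
      using F g by (auto intro: smooth_on_subset simp: N_def)
    fix q assume q: "q \<in> N"
    note c = contact_map_on_horizontal[OF contact fN(1,2)[OF q], folded F_def g_def]
    \<comment> \<open>The term with \<open>Zf\<close> of the conjugate of \<open>F\<close> drops
      out, being a multiple of the conjugate of \<open>Zbar F q\<close>.\<close>
    show "Zf g q = \<i> * (cnj (F q) * Zf F q)"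
      using c(1) ZbF[OF q] horizontal_cnj(1)[OF fN(3)[OF q]] by (simp add: F_def)
    show "Zbar g q = - \<i> * (F q * Zbar (\<lambda>q. cnj (F q)) q)"
      using c(2) ZbF[OF q] by (simp add: F_def)
  qed (use ZbF fN pN in auto)
  \<comment> \<open>Division by \<open>2 * (Zf F p)\<^sup>2\<close> turns the third-order identity
    into the Schwarzian equation.\<close>
  then show "S_CL f p = 0"
    using nz unfolding S_CL_def Let_def F_def[symmetric]
    by (simp add: field_simps power2_eq_square)
qed

end
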